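(* Let $X$ be a nonnegative integrable real random variable, let $a > 0$, and let $U$ be a random variable independent of $X$ that is uniformly distributed over $[-a,a]$. Then $$\mathbb{P}(X + U \geq a) \leq \frac{1}{2}\cdot\frac{\mathbb{E}[X]}{a}.$$ *)

theory Defs
  imports "HOL-Probability.Probability"
begin

end

theory Submission
  imports Defs
begin

text \<open>
  Condition on \<open>X\<close>. When \<open>X = x \<ge> 0\<close>, the event becomes \<open>U \<ge> a - x\<close>, so \<open>U\<close> has to lie in
  \<open>[a - x, a]\<close>, an interval of length \<open>x\<close>, on which the density of \<open>U\<close> is at most \<open>1/(2a)\<close>. The
  conditional probability is therefore at most \<open>x/(2a)\<close> (\<open>uniform_upper_tail_le\<close>), a bound that is
  linear in \<open>x\<close>; averaging it over \<open>X\<close> (\<open>emeasure_indep_sum_ge\<close>) gives \<open>E[X]/(2a)\<close>. The smoothing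
  by \<open>U\<close> thus gains the factor \<open>1/2\<close> over Markov's inequality.
\<close>

text \<open>
  Independence makes the law of \<open>(X, Y)\<close> a product, so Tonelli's theorem applies to the half-plane
  \<open>x + y \<ge> t\<close>. The inner measure is that of an event in the original space, with \<open>\<omega>\<close> held fixed
  and only \<open>Y\<close> random.
\<close>
lemma (in prob_space) emeasure_indep_sum_ge:
  fixes X Y :: "'a \<Rightarrow> real"
  assumes indep: "indep_var borel X borel Y"
  shows "emeasure M {\<omega> \<in> space M. t \<le> X \<omega> + Y \<omega>} =
         (\<integral>\<^sup>+\<omega>. emeasure M {\<omega>' \<in> space M. t - X \<omega> \<le> Y \<omega>'} \<partial>M)"
proof -
  have X[measurable]: "X \<in> borel_measurable M" and Y[measurable]: "Y \<in> borel_measurable M"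
    using indep_var_rv1[OF indep] indep_var_rv2[OF indep] by auto
  interpret Y: prob_space "distr M borel Y" by (rule prob_space_distr) simp
  define H :: "(real \<times> real) set" where "H = {p. t \<le> fst p + snd p}"
  have "closed H" unfolding H_def by (intro closed_Collect_le continuous_intros)
  then have H[measurable]: "H \<in> sets (borel \<Otimes>\<^sub>M borel)" unfolding borel_prod by (rule borel_closed)
  have law: "distr M borel X \<Otimes>\<^sub>M distr M borel Y = distr M (borel \<Otimes>\<^sub>M borel) (\<lambda>\<omega>. (X \<omega>, Y \<omega>))"
    using indep unfolding indep_var_distribution_eq by auto
  have "emeasure M {\<omega> \<in> space M. t \<le> X \<omega> + Y \<omega>} =
        emeasure (distr M (borel \<Otimes>\<^sub>M borel) (\<lambda>\<omega>. (X \<omega>, Y \<omega>))) H"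
    by (simp add: emeasure_distr H) (simp add: H_def vimage_def Int_def conj_commute)
  also have "\<dots> = (\<integral>\<^sup>+x. emeasure (distr M borel Y) (Pair x -` H) \<partial>distr M borel X)"
    unfolding law[symmetric] by (rule Y.emeasure_pair_measure_alt) simp
  also have "\<dots> = (\<integral>\<^sup>+\<omega>. emeasure (distr M borel Y) (Pair (X \<omega>) -` H) \<partial>M)"
    by (rule nn_integral_distr) (auto intro!: Y.measurable_emeasure_Pair)
  also have "\<dots> = (\<integral>\<^sup>+\<omega>. emeasure M {\<omega>' \<in> space M. t - X \<omega> \<le> Y \<omega>'} \<partial>M)"
  proof (rule nn_integral_cong)
    fix \<omega>
    have "Pair (X \<omega>) -` H = {t - X \<omega>..}" by (auto simp: H_def)
    then show "emeasure (distr M borel Y) (Pair (X \<omega>) -` H) =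
               emeasure M {\<omega>' \<in> space M. t - X \<omega> \<le> Y \<omega>'}"
      by (simp add: emeasure_distr vimage_def Int_def conj_commute)
  qed
  finally show ?thesis .
qed

text \<open>
  The part of the half-line \<open>[a - x, \<infinity>)\<close> inside \<open>[-a, a]\<close> is contained in \<open>[a - x, a]\<close>. For
  \<open>x \<le> 2a\<close> this is an equality; beyond that the bound exceeds \<open>1\<close>.
\<close>
lemma uniform_upper_tail_le:
  fixes U :: "'a \<Rightarrow> real"
  assumes U: "distributed M lborel U (\<lambda>u. indicator {-a..a} u / measure lborel {-a..a})"
    and "0 < a" "0 \<le> x"
  shows "emeasure M {\<omega> \<in> space M. a - x \<le> U \<omega>} \<le> ennreal (x / (2 * a))"
proof -
  have "emeasure M {\<omega> \<in> space M. a - x \<le> U \<omega>} = emeasure M (U -` {a - x..} \<inter> space M)"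
    by (rule arg_cong[where f = "emeasure M"]) auto
  also have "\<dots> = (\<integral>\<^sup>+u. ennreal (indicator {-a..a} u / measure lborel {-a..a}) * indicator {a - x..} u \<partial>lborel)"
    by (rule distributed_emeasure[OF U]) simp
  also have "\<dots> \<le> (\<integral>\<^sup>+u. ennreal (1 / (2 * a)) * indicator {a - x..a} u \<partial>lborel)"
    using \<open>0 < a\<close> by (intro nn_integral_mono) (auto simp: indicator_def)
  also have "\<dots> = ennreal (1 / (2 * a)) * ennreal x"
    using \<open>0 \<le> x\<close> by (simp add: nn_integral_cmult)
  also have "\<dots> = ennreal (x / (2 * a))"
    using assms(2,3) by (simp flip: ennreal_mult)
  finally show ?thesis .
qed

theorem lemma5:
  fixes M :: "'a measure" and X U :: "'a \<Rightarrow> real" and a :: real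
  assumes "prob_space M"
    and "integrable M X"
    and "AE \<omega> in M. 0 \<le> X \<omega>"
    and "0 < a"
    and "distributed M lborel U (\<lambda>u. indicator {-a..a} u / measure lborel {-a..a})"
    and "prob_space.indep_var M borel X borel U"
  shows "measure M {\<omega> \<in> space M. X \<omega> + U \<omega> \<ge> a} \<le> 1 / 2 * ((\<integral>\<omega>. X \<omega> \<partial>M) / a)"
proof -
  interpret prob_space M by fact
  have "emeasure M {\<omega> \<in> space M. X \<omega> + U \<omega> \<ge> a} =
        (\<integral>\<^sup>+\<omega>. emeasure M {\<omega>' \<in> space M. a - X \<omega> \<le> U \<omega>'} \<partial>M)"
    by (rule emeasure_indep_sum_ge[OF assms(6)])
  also have "\<dots> \<le> (\<integral>\<^sup>+\<omega>. ennreal (X \<omega> / (2 * a)) \<partial>M)"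
    using assms(3) by (intro nn_integral_mono_AE) (auto intro: uniform_upper_tail_le[OF assms(5,4)])
  also have "\<dots> = ennreal (\<integral>\<omega>. X \<omega> / (2 * a) \<partial>M)"
    using assms(2-4) by (intro nn_integral_eq_integral) auto
  finally have "emeasure M {\<omega> \<in> space M. X \<omega> + U \<omega> \<ge> a} \<le> ennreal (\<integral>\<omega>. X \<omega> / (2 * a) \<partial>M)" .
  moreover have "0 \<le> (\<integral>\<omega>. X \<omega> / (2 * a) \<partial>M)"
    using assms(3,4) by (intro integral_nonneg_AE) auto
  ultimately show ?thesis
    by (simp add: emeasure_eq_measure)
qed

end
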